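(* Let $X$ be a (real) Banach space with norm $|\cdot|$, ordered by a cone $K$, such that the norm is semi-monotone with respect to $K$. Let $L\colon X\to X$ be a linear operator, $F\colon K\to K$ a continuous (nonlinear) mapping, and $N:=LF$. Let $\Phi\colon K\to\mathbb{R}_+$ satisfy $\Phi(\alpha u)=\alpha\Phi(u)$ for all $\alpha>0$, $u\in K$, and $\Phi(u)=0$ if and only if $u=0$. Assume: (i) $L(K)\subset K$, and $L$ admits an eigenvalue $\lambda_1>0$ with a corresponding eigenvector $\varphi_1\in K\setminus\{0\}$, i.e. $L\varphi_1=\lambda_1\varphi_1$; (ii) for $u,v\in K$, $0\le u\le v$ implies $F(u)\le F(v)$; (iii) there exists a constant $r>0$ such that $F(\lambda_1u)\ge u$ for all $u\in K$ with $\Phi(u)=r$; (iv) there exist $\alpha>0$ and $\mu\in K\setminus\{0\}$ such that $L\mu\le\alpha\mu$ and $F(\alpha\mu)\le\mu$; (v) with $\underline{u}=\frac{r}{\Phi(\varphi_1)}L(\varphi_1)$ and $\overline{u}=L\mu$, one has $\underline{u}\le\overline{u}$. If, in addition, the operator $L$ is completely continuous, then there exists $u^\ast\in[\underline{u},\overline{u}]$ such that $u^\ast=N(u^\ast)$.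
   Context: A cone $K\subset X$ is a closed convex set with $tK\subset K$ for all $t\ge0$, $K\cap(-K)=\{0\}$ and $K\ne\{0\}$. The order is $u\le v$ iff $v-u\in K$, and $[\underline{u},\overline{u}]=\{u\in X:\underline{u}\le u\le\overline{u}\}$. The norm is semi-monotone if there is $\gamma>0$ such that $0\le u\le v$ implies $|u|\le\gamma|v|$. $N=LF$ denotes the composition $N(u)=L(F(u))$, $u\in K$. Completely continuous means continuous and mapping bounded sets into relatively compact sets. *)

theory Defs
  imports "HOL-Analysis.Analysis"
begin

definition order_cone :: "'a::real_normed_vector set \<Rightarrow> bool" where
  "order_cone K \<longleftrightarrow> closed K \<and> convex K \<and> cone K \<and> K \<inter> uminus ` K = {0} \<and> K \<noteq> {0}"

definition cone_le :: "'a::real_normed_vector set \<Rightarrow> 'a \<Rightarrow> 'a \<Rightarrow> bool" where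
  "cone_le K u v \<longleftrightarrow> v - u \<in> K"

definition cone_interval :: "'a::real_normed_vector set \<Rightarrow> 'a \<Rightarrow> 'a \<Rightarrow> 'a set" where
  "cone_interval K a b = {u. cone_le K a u \<and> cone_le K u b}"

definition semi_monotone_norm :: "'a::real_normed_vector set \<Rightarrow> bool" where
  "semi_monotone_norm K \<longleftrightarrow>
     (\<exists>\<gamma>>0. \<forall>u v. cone_le K 0 u \<and> cone_le K u v \<longrightarrow> norm u \<le> \<gamma> * norm v)"

definition completely_continuous ::
    "('a::real_normed_vector \<Rightarrow> 'b::real_normed_vector) \<Rightarrow> bool" where
  "completely_continuous f \<longleftrightarrow>
     continuous_on UNIV f \<and> (\<forall>B. bounded B \<longrightarrow> compact (closure (f ` B)))"

end

theory Submission
  imports Defs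
begin

text \<open>
  The two points \<open>u_low\<close> and \<open>u_upp\<close> are a sub- and a supersolution of \<open>u = N u\<close>, and \<open>N\<close> is
  monotone because both \<open>F\<close> and the positive linear operator \<open>L\<close> are. Indeed \<open>u_low\<close> equals
  \<open>lam\<^sub>1\<close> times the multiple \<open>w\<close> of \<open>\<phi>\<^sub>1\<close> that satisfies \<open>\<Phi> w = r\<close>, so that (iii) says
  \<open>w \<le> F u_low\<close>, and applying \<open>L\<close> gives \<open>u_low = L w \<le> N u_low\<close>. On the other side (iv) gives
  \<open>F (L \<mu>) \<le> F (\<alpha> \<mu>) \<le> \<mu>\<close>, and applying \<open>L\<close> gives \<open>N u_upp \<le> u_upp\<close>.

  Hence the iterates of \<open>N\<close> starting at \<open>u_low\<close> increase and stay below \<open>u_upp\<close>. Semi-monotonicity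
  of the norm enters twice. It makes the set of all \<open>F u\<close> with \<open>u\<close> in the order interval bounded,
  so that \<open>L\<close>, being completely continuous, sends it into a compact set; this set contains every
  iterate after the first, hence some subsequence converges. And it squeezes the
  distance from the limit along the whole monotone sequence, so that a convergent subsequence
  forces convergence of the sequence itself (lemma \<open>increasing_seq_tendsto\<close>). By continuity
  the limit is a fixed point (lemma \<open>monotone_iteration_fixed_point\<close>).
\<close>

lemma order_cone_zero: "order_cone K \<Longrightarrow> 0 \<in> K"
  by (auto simp: order_cone_def)

lemma order_cone_scaleR: "order_cone K \<Longrightarrow> u \<in> K \<Longrightarrow> c \<ge> 0 \<Longrightarrow> c *\<^sub>R u \<in> K"
  by (auto simp: order_cone_def cone_def)

lemma order_cone_add: "order_cone K \<Longrightarrow> u \<in> K \<Longrightarrow> v \<in> K \<Longrightarrow> u + v \<in> K"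
  using convex_cone[of K] by (auto simp: order_cone_def)

lemma cone_le_zero_iff: "cone_le K 0 u \<longleftrightarrow> u \<in> K"
  by (simp add: cone_le_def)

lemma cone_le_refl: "order_cone K \<Longrightarrow> cone_le K u u"
  by (simp add: cone_le_def order_cone_zero)

lemma cone_le_trans: "order_cone K \<Longrightarrow> cone_le K u v \<Longrightarrow> cone_le K v w \<Longrightarrow> cone_le K u w"
  using order_cone_add[of K "v - u" "w - v"] by (simp add: cone_le_def)

lemma cone_ge_mem: "order_cone K \<Longrightarrow> u \<in> K \<Longrightarrow> cone_le K u v \<Longrightarrow> v \<in> K"
  using cone_le_trans[of K 0 u v] by (simp add: cone_le_zero_iff)

lemma cone_le_limit:
  assumes "order_cone K" and "x \<longlonglongrightarrow> u" and "y \<longlonglongrightarrow> v" and "\<And>n. cone_le K (x n) (y n)"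
  shows "cone_le K u v"
proof -
  have "closed K" using assms(1) by (simp add: order_cone_def)
  moreover have "(\<lambda>n. y n - x n) \<longlonglongrightarrow> v - u" by (intro tendsto_diff assms)
  ultimately show ?thesis
    using assms(4) closed_sequentially[of K "\<lambda>n. y n - x n"] unfolding cone_le_def by blast
qed

lemma linear_cone_le:
  assumes "linear L" and "L ` K \<subseteq> K" and "cone_le K u v"
  shows "cone_le K (L u) (L v)"
  using assms by (auto simp: cone_le_def linear_diff[symmetric])

lemma cone_interval_bounded:
  assumes "semi_monotone_norm K"
  shows "bounded (cone_interval K 0 b)"
proof -
  from assms obtain \<gamma> where
    "\<And>u v. cone_le K 0 u \<Longrightarrow> cone_le K u v \<Longrightarrow> norm u \<le> \<gamma> * norm v"
    unfolding semi_monotone_norm_def by blast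
  then show ?thesis
    by (intro boundedI[where B = "\<gamma> * norm b"]) (auto simp: cone_interval_def)
qed

text \<open>
  For \<open>n\<close> beyond \<open>s k\<close> one has \<open>0 \<le> l - x n \<le> l - x (s k)\<close>, so the semi-monotone norm bounds the
  distance from \<open>l\<close> of all later terms by a constant times that of a single term of the
  subsequence.
\<close>
lemma increasing_seq_tendsto:
  assumes K: "order_cone K" "semi_monotone_norm K"
    and incr: "\<And>n. cone_le K (x n) (x (Suc n))"
    and s: "strict_mono (s :: nat \<Rightarrow> nat)" "(\<lambda>k. x (s k)) \<longlonglongrightarrow> l"
  shows "x \<longlonglongrightarrow> l"
proof -
  have mono: "cone_le K (x m) (x n)" if "m \<le> n" for m n
    using that
    by (induction rule: dec_induct) (auto intro: cone_le_refl cone_le_trans K incr)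
  have below: "cone_le K (x n) l" for n
  proof (rule cone_le_limit[OF K(1)])
    show "(\<lambda>k. x n) \<longlonglongrightarrow> x n" by simp
    show "(\<lambda>k. x (s (k + n))) \<longlonglongrightarrow> l" by (rule LIMSEQ_ignore_initial_segment[OF s(2)])
    show "cone_le K (x n) (x (s (k + n)))" for k
      using seq_suble[OF s(1), of "k + n"] by (intro mono) simp
  qed
  from K(2) obtain \<gamma> where \<gamma>: "\<gamma> > 0"
    "\<And>u v. cone_le K 0 u \<Longrightarrow> cone_le K u v \<Longrightarrow> norm u \<le> \<gamma> * norm v"
    unfolding semi_monotone_norm_def by blast
  show ?thesis
  proof (rule LIMSEQ_I)
    fix e :: real assume "e > 0"
    then obtain k where k: "norm (x (s k) - l) < e / \<gamma>"
      using LIMSEQ_D[OF s(2), of "e / \<gamma>"] \<gamma>(1) by (meson divide_pos_pos order_refl)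
    have "norm (x n - l) < e" if "n \<ge> s k" for n
    proof -
      have "norm (l - x n) \<le> \<gamma> * norm (l - x (s k))"
        using below[of n] mono[OF that] by (intro \<gamma>(2)) (auto simp: cone_le_def)
      also have "\<dots> < e"
        using k \<gamma>(1) by (simp add: norm_minus_commute pos_less_divide_eq mult.commute)
      finally show ?thesis by (simp add: norm_minus_commute)
    qed
    then show "\<exists>n0. \<forall>n\<ge>n0. norm (x n - l) < e" by blast
  qed
qed

text \<open>
  The iterates from the subsolution \<open>a\<close> increase inside the interval; compactness provides a
  convergent subsequence, and convergence of the full sequence allows passing to the limit in
  \<open>x (Suc n) = T (x n)\<close>.
\<close>
lemma monotone_iteration_fixed_point:
  assumes K: "order_cone K" "semi_monotone_norm K"
    and ab: "cone_le K a b" "cone_le K a (T a)" "cone_le K (T b) b"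
    and mono: "\<And>u v. u \<in> cone_interval K a b \<Longrightarrow> v \<in> cone_interval K a b \<Longrightarrow>
                 cone_le K u v \<Longrightarrow> cone_le K (T u) (T v)"
    and cont: "continuous_on (cone_interval K a b) T"
    and C: "compact C" "T ` cone_interval K a b \<subseteq> C"
  shows "\<exists>u\<in>cone_interval K a b. u = T u"
proof -
  define x where "x n = (T ^^ n) a" for n
  have x_Suc: "x (Suc n) = T (x n)" for n by (simp add: x_def)
  have a: "a \<in> cone_interval K a b" and b: "b \<in> cone_interval K a b"
    using ab(1) by (auto simp: cone_interval_def cone_le_refl[OF K(1)])
  have T_interval: "T u \<in> cone_interval K a b" if u: "u \<in> cone_interval K a b" for u
  proof -
    have "cone_le K (T a) (T u)" "cone_le K (T u) (T b)"
      using u by (auto intro!: mono a b simp: cone_interval_def)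
    then show ?thesis
      using ab(2,3) by (auto simp: cone_interval_def intro: cone_le_trans[OF K(1)])
  qed
  have x_interval: "x n \<in> cone_interval K a b" for n
  proof (induction n)
    case 0
    show ?case by (simp add: x_def a)
  qed (simp add: x_Suc T_interval)
  have incr: "cone_le K (x n) (x (Suc n))" for n
  proof (induction n)
    case 0
    show ?case using ab(2) by (simp add: x_def)
  next
    case (Suc n)
    show ?case
      unfolding x_Suc[of "Suc n"] x_Suc[of n]
      by (rule mono) (use Suc x_interval T_interval in \<open>auto simp: x_Suc\<close>)
  qed
  have "\<forall>n. x (Suc n) \<in> C" using C(2) x_interval by (auto simp: x_Suc)
  then obtain l s where s: "strict_mono (s :: nat \<Rightarrow> nat)" "((\<lambda>n. x (Suc n)) \<circ> s) \<longlonglongrightarrow> l"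
    using compact_imp_seq_compact[OF C(1)] unfolding seq_compact_def by meson
  have lim: "x \<longlonglongrightarrow> l"
    by (rule increasing_seq_tendsto[where s = "Suc \<circ> s", OF K])
       (use s incr in \<open>auto simp: strict_mono_def o_def\<close>)
  have l: "l \<in> cone_interval K a b"
    using x_interval
    by (auto simp: cone_interval_def intro: cone_le_limit[OF K(1) tendsto_const lim]
        cone_le_limit[OF K(1) lim tendsto_const])
  have "(\<lambda>n. T (x n)) \<longlonglongrightarrow> T l"
    by (rule continuous_on_tendsto_compose[OF cont lim l]) (simp add: x_interval)
  then have "(\<lambda>n. x (Suc n)) \<longlonglongrightarrow> T l" by (simp add: x_Suc)
  with LIMSEQ_Suc[OF lim] have "l = T l" by (rule LIMSEQ_unique)
  with l show ?thesis by blast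
qed

theorem theorem5:
  fixes K :: "'a::banach set"
    and L F N :: "'a \<Rightarrow> 'a"
    and \<Phi> :: "'a \<Rightarrow> real"
    and lam\<^sub>1 r \<alpha> :: real
    and \<phi>\<^sub>1 \<mu> u_low u_upp :: 'a
  assumes "order_cone K"
    and "semi_monotone_norm K"
    and "linear L"
    and "F \<in> K \<rightarrow> K" and "continuous_on K F"
    and "\<And>u. u \<in> K \<Longrightarrow> N u = L (F u)"
    and "\<And>u. u \<in> K \<Longrightarrow> \<Phi> u \<ge> 0"
    and "\<And>t u. t > 0 \<Longrightarrow> u \<in> K \<Longrightarrow> \<Phi> (t *\<^sub>R u) = t * \<Phi> u"
    and "\<And>u. u \<in> K \<Longrightarrow> \<Phi> u = 0 \<longleftrightarrow> u = 0"
    and i: "L ` K \<subseteq> K" "lam\<^sub>1 > 0" "\<phi>\<^sub>1 \<in> K - {0}" "L \<phi>\<^sub>1 = lam\<^sub>1 *\<^sub>R \<phi>\<^sub>1"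
    and ii: "\<And>u v. u \<in> K \<Longrightarrow> v \<in> K \<Longrightarrow> cone_le K 0 u \<Longrightarrow> cone_le K u v \<Longrightarrow>
               cone_le K (F u) (F v)"
    and iii: "r > 0" "\<And>u. u \<in> K \<Longrightarrow> \<Phi> u = r \<Longrightarrow> cone_le K u (F (lam\<^sub>1 *\<^sub>R u))"
    and iv: "\<alpha> > 0" "\<mu> \<in> K - {0}" "cone_le K (L \<mu>) (\<alpha> *\<^sub>R \<mu>)" "cone_le K (F (\<alpha> *\<^sub>R \<mu>)) \<mu>"
    and v: "u_low = (r / \<Phi> \<phi>\<^sub>1) *\<^sub>R L \<phi>\<^sub>1" "u_upp = L \<mu>" "cone_le K u_low u_upp"
    and "completely_continuous L"
  shows "\<exists>u\<in>cone_interval K u_low u_upp. u = N u"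
proof -
  note K = assms(1,2) and L = \<open>linear L\<close>
  have F_mem: "F u \<in> K" if "u \<in> K" for u using \<open>F \<in> K \<rightarrow> K\<close> that by blast
  have L_mem: "L u \<in> K" if "u \<in> K" for u using i(1) that by blast
  note F_mono = ii[unfolded cone_le_zero_iff]
  note L_mono = linear_cone_le[OF L i(1)]
  have L_cont: "continuous_on UNIV L"
    and L_compact: "\<And>B. bounded B \<Longrightarrow> compact (closure (L ` B))"
    using \<open>completely_continuous L\<close> by (auto simp: completely_continuous_def)

  define w where "w = (r / \<Phi> \<phi>\<^sub>1) *\<^sub>R \<phi>\<^sub>1"
  have \<phi>: "\<phi>\<^sub>1 \<in> K" "\<Phi> \<phi>\<^sub>1 > 0" using i(3) assms(7,9)[of \<phi>\<^sub>1] by auto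
  have w: "w \<in> K" "\<Phi> w = r"
    using \<phi> \<open>r > 0\<close> assms(8)[of "r / \<Phi> \<phi>\<^sub>1" \<phi>\<^sub>1]
    by (auto simp: w_def intro: order_cone_scaleR[OF K(1)])
  have low: "u_low = L w" "u_low = lam\<^sub>1 *\<^sub>R w"
    by (simp_all add: v(1) w_def linear_scale[OF L] i(4))
  have low_mem: "u_low \<in> K" unfolding low(1) by (rule L_mem[OF w(1)])
  have upp_mem: "u_upp \<in> K" unfolding v(2) using iv(2) by (auto intro: L_mem)
  have interval_mem: "u \<in> K" if "u \<in> cone_interval K u_low u_upp" for u
    using that cone_ge_mem[OF K(1) low_mem] by (auto simp: cone_interval_def)

  have sub: "cone_le K u_low (L (F u_low))"
    using L_mono[OF iii(2)[OF w]] by (simp flip: low)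
  have "cone_le K (F u_upp) (F (\<alpha> *\<^sub>R \<mu>))"
    unfolding v(2) by (rule F_mono) (use iv(1-3) in \<open>auto intro: L_mem order_cone_scaleR[OF K(1)]\<close>)
  then have "cone_le K (F u_upp) \<mu>" using iv(4) by (rule cone_le_trans[OF K(1)])
  then have super: "cone_le K (L (F u_upp)) u_upp" unfolding v(2) by (rule L_mono)

  define C where "C = closure (L ` cone_interval K 0 (F u_upp))"
  have "\<exists>u\<in>cone_interval K u_low u_upp. u = L (F u)"
  proof (rule monotone_iteration_fixed_point[OF K v(3) sub super])
    show "cone_le K (L (F u)) (L (F v))"
      if "u \<in> cone_interval K u_low u_upp" "v \<in> cone_interval K u_low u_upp" "cone_le K u v" for u v
      using that by (intro L_mono F_mono interval_mem)
    have "continuous_on (cone_interval K u_low u_upp) F"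
      using \<open>continuous_on K F\<close> interval_mem by (auto intro: continuous_on_subset)
    then show "continuous_on (cone_interval K u_low u_upp) (\<lambda>u. L (F u))"
      by (rule continuous_on_compose2[OF L_cont]) simp
    show "compact C"
      unfolding C_def by (rule L_compact[OF cone_interval_bounded[OF K(2)]])
    have "F u \<in> cone_interval K 0 (F u_upp)" if u: "u \<in> cone_interval K u_low u_upp" for u
    proof -
      have "cone_le K u u_upp" using u by (simp add: cone_interval_def)
      with interval_mem[OF u] upp_mem show ?thesis
        by (auto simp: cone_interval_def cone_le_zero_iff intro: F_mono F_mem)
    qed
    then show "(\<lambda>u. L (F u)) ` cone_interval K u_low u_upp \<subseteq> C"
      unfolding C_def by (intro subset_trans[OF _ closure_subset]) blast
  qed
  then show ?thesis using assms(6) interval_mem by metis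
qed

end
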